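(* Let $G$ be a $2r$-regular graph of order $m\ge 3$ with $\chi(G)=\chi_{la}(G)$. If $r\ge 2$, $r\ge t\ge 1$ and $m-2t\ge 2$, then $\chi_{la}(G\vee O_{m-2t})=\chi_{la}(G)+1$. In particular, let $G_0=G$ and $G_{k+1}=G_k\vee O_{m-2r}$ for $k\ge 0$; if $m$ is even and $m-2r\ge 2$, then $G_{k+1}$ is a $(2r+(k+1)(m-2r))$-regular graph of order $m+(k+1)(m-2r)$, and $\chi_{la}(G_k)=\chi_{la}(G)+k$ for all $k\ge 0$.
   Context: $O_n$ denotes the graph on $n$ vertices with no edges. For vertex-disjoint graphs $G,H$, the join $G\vee H$ has vertex set $V(G)\cup V(H)$ and edge set $E(G)\cup E(H)\cup\{uv: u\in V(G), v\in V(H)\}$; in the iteration each $O_{m-2r}$ is a fresh vertex-disjoint copy. $\chi$ is the chromatic number. For a simple graph with $q$ edges, a bijection $f:E\to\{1,\dots,q\}$ is a local antimagic labeling if $f^+(u)\neq f^+(v)$ for every edge $uv$, where $f^+(u)=\sum_{e\ni u} f(e)$; $\chi_{la}$ is the minimum number of distinct values of $f^+$ over all local antimagic labelings. *)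

theory Defs
  imports Main "HOL-Library.Extended_Nat"
begin

record 'a graph =
  verts :: "'a set"
  edges :: "'a set set"

definition simple_graph :: "'a graph \<Rightarrow> bool" where
  "simple_graph G \<longleftrightarrow>
     finite (verts G) \<and> edges G \<subseteq> {e. e \<subseteq> verts G \<and> card e = 2}"

definition degree :: "'a graph \<Rightarrow> 'a \<Rightarrow> nat" where
  "degree G v = card {e \<in> edges G. v \<in> e}"

definition regular :: "nat \<Rightarrow> 'a graph \<Rightarrow> bool" where
  "regular d G \<longleftrightarrow> (\<forall>v \<in> verts G. degree G v = d)"

text \<open>The copy of the edgeless graph \<open>O\<^sub>n\<close> whose vertices are the \<open>n\<close> elements of \<open>W\<close>.\<close>

definition edgeless :: "'a set \<Rightarrow> 'a graph" where
  "edgeless W = \<lparr>verts = W, edges = {}\<rparr>"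

definition graph_join :: "'a graph \<Rightarrow> 'a graph \<Rightarrow> 'a graph" where
  "graph_join G H =
     \<lparr>verts = verts G \<union> verts H,
      edges = edges G \<union> edges H \<union> {{u, v} | u v. u \<in> verts G \<and> v \<in> verts H}\<rparr>"

text \<open>
  \<open>iterated_join G n k H\<close>: the graph \<open>H\<close> arises from \<open>G\<close> by joining \<open>k\<close> times with a copy
  of \<open>O\<^sub>n\<close>, each copy being vertex-disjoint from the graph built so far. The join depends, up to
  isomorphism, only on \<open>n\<close>, but the fresh vertices are not canonical, hence a relation.
\<close>

inductive iterated_join :: "'a graph \<Rightarrow> nat \<Rightarrow> nat \<Rightarrow> 'a graph \<Rightarrow> bool"
  for G :: "'a graph" and n :: nat where
  base: "iterated_join G n 0 G"
| step: "iterated_join G n k H \<Longrightarrow> finite W \<Longrightarrow> card W = n \<Longrightarrow> verts H \<inter> W = {} \<Longrightarrow>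
         iterated_join G n (Suc k) (graph_join H (edgeless W))"

lemma iterated_join_exists:
  assumes "infinite (UNIV :: 'a set)" and "finite (verts (G :: 'a graph))"
  shows "\<exists>H. iterated_join G n k H \<and> finite (verts H)"
proof (induction k)
  case 0
  show ?case using assms(2) by (blast intro: iterated_join.base)
next
  case (Suc k)
  then obtain H where H: "iterated_join G n k H" "finite (verts H)" by blast
  have "infinite (- verts H)"
    using assms(1) H(2) by (metis Compl_eq_Diff_UNIV Diff_infinite_finite)
  then obtain W where W: "W \<subseteq> - verts H" "finite W" "card W = n"
    using infinite_arbitrarily_large by blast
  then have "verts H \<inter> W = {}" by blast
  with H W have "iterated_join G n (Suc k) (graph_join H (edgeless W))"
    by (intro iterated_join.step)
  moreover have "finite (verts (graph_join H (edgeless W)))"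
    using H(2) W(2) by (simp add: graph_join_def edgeless_def)
  ultimately show ?case by blast
qed

definition proper_coloring :: "'a graph \<Rightarrow> ('a \<Rightarrow> nat) \<Rightarrow> bool" where
  "proper_coloring G c \<longleftrightarrow> (\<forall>u v. {u, v} \<in> edges G \<longrightarrow> c u \<noteq> c v)"

definition chromatic_number :: "'a graph \<Rightarrow> nat" where
  "chromatic_number G = (LEAST k. \<exists>c. proper_coloring G c \<and> c ` verts G \<subseteq> {..<k})"

definition vertex_sum :: "'a graph \<Rightarrow> ('a set \<Rightarrow> nat) \<Rightarrow> 'a \<Rightarrow> nat" where
  "vertex_sum G f u = (\<Sum>e \<in> {e \<in> edges G. u \<in> e}. f e)"

definition local_antimagic_labeling :: "'a graph \<Rightarrow> ('a set \<Rightarrow> nat) \<Rightarrow> bool" where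
  "local_antimagic_labeling G f \<longleftrightarrow>
     bij_betw f (edges G) {1..card (edges G)} \<and>
     (\<forall>u v. {u, v} \<in> edges G \<longrightarrow> vertex_sum G f u \<noteq> vertex_sum G f v)"

text \<open>
  The minimum lives in the extended naturals, so that it is \<open>\<infinity>\<close>, and not an arbitrary number,
  for a graph that has no local antimagic labeling.
\<close>

definition chi_la :: "'a graph \<Rightarrow> enat" where
  "chi_la G = (INF f \<in> {f. local_antimagic_labeling G f}. enat (card (vertex_sum G f ` verts G)))"

end

theory Submission imports Defs
begin

text \<open>
  Let \<open>n\<close> be the number of vertices of the edgeless graph. Label the \<open>m n\<close> new edges by a magic
  \<open>n \<times> m\<close> rectangle on \<open>1, \<dots>, m n\<close> and shift an optimal labeling of \<open>G\<close> by \<open>m n\<close>. By regularity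
  all vertex sums in \<open>G\<close> change by the same constant, the new vertices share one sum, and placing
  the labels of \<open>G\<close> on top makes that sum smaller than every sum in \<open>G\<close>. This gives
  \<open>\<chi>\<^sub>l\<^sub>a(G) + 1\<close> as an upper bound, and \<open>\<chi>(G \<or> O\<^sub>n) \<ge> \<chi>(G) + 1 = \<chi>\<^sub>l\<^sub>a(G) + 1\<close> is a lower bound.
  Hence the join again satisfies \<open>\<chi> = \<chi>\<^sub>l\<^sub>a\<close>, and one can iterate.

  Magic rectangles are obtained, after centering, by gluing arrays with vanishing row and column
  sums. Blocks \<open>2 \<times> 4\<close> with rows \<open>\<plusminus>(a, -(a+s), -(a+2s), a+3s)\<close> handle even sides. For odd sides, a triple
  \<open>a + b = c\<close> gives a \<open>3 \<times> 2\<close> strip, and \<open>1, \<dots>, 3h+1\<close> is a disjoint union of \<open>h\<close> such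
  triples and a single number \<open>v\<close>: pairs in \<open>h+1, \<dots>, 3h+1\<close> with differences \<open>1, \<dots>, h\<close> are
  found by nesting the odd differences and, around \<open>v\<close>, the even ones.
\<close>

section \<open>Zero-sum arrays\<close>

text \<open>
  Only a lower bound \<open>S\<close> for the set of entries is recorded: in the end \<open>S\<close> has \<open>p q\<close> elements, so
  counting shows that every element of \<open>S\<close> occurs exactly once and nothing else does.
\<close>

definition zero_sum_array :: "nat \<Rightarrow> nat \<Rightarrow> int set \<Rightarrow> bool" where
  "zero_sum_array p q S \<longleftrightarrow>
     (\<exists>f. (\<forall>i<p. (\<Sum>j<q. f i j) = 0) \<and> (\<forall>j<q. (\<Sum>i<p. f i j) = 0) \<and>
          (\<forall>x\<in>S. \<exists>i<p. \<exists>j<q. f i j = x))"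

section \<open>Gluing zero-sum arrays\<close>

definition plus_minus :: "int set \<Rightarrow> int set" where
  "plus_minus A = A \<union> uminus ` A"

lemma plus_minus_iff: "x \<in> plus_minus A \<longleftrightarrow> x \<in> A \<or> - x \<in> A"
  unfolding plus_minus_def by force

lemma plus_minus_Un: "plus_minus (A \<union> B) = plus_minus A \<union> plus_minus B"
  unfolding plus_minus_def by auto

lemma plus_minus_mono: "A \<subseteq> B \<Longrightarrow> plus_minus A \<subseteq> plus_minus B"
  unfolding plus_minus_def by auto

lemma zero_sum_array_mono:
  "zero_sum_array p q S \<Longrightarrow> T \<subseteq> S \<Longrightarrow> zero_sum_array p q T"
  unfolding zero_sum_array_def by blast

lemma zero_sum_array_transpose:
  "zero_sum_array p q S \<Longrightarrow> zero_sum_array q p S"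
  unfolding zero_sum_array_def
  by (elim exE) (rule_tac x = "\<lambda>i j. f j i" in exI, blast)

lemma zero_sum_array_empty: "zero_sum_array p 0 {}"
  unfolding zero_sum_array_def by simp

lemma sum_lessThan_split:
  fixes f :: "nat \<Rightarrow> 'b::comm_monoid_add"
  shows "(\<Sum>j<a + b. f j) = (\<Sum>j<a. f j) + (\<Sum>j<b. f (a + j))"
  by (induction b) (simp_all add: add.assoc)

text \<open>The columns are inherited from the two parts, and each row sum is a sum of two
  zeros.\<close>

lemma zero_sum_array_beside:
  assumes "zero_sum_array p q S" "zero_sum_array p q' T"
  shows "zero_sum_array p (q + q') (S \<union> T)"
proof -
  obtain f where f: "\<And>i. i < p \<Longrightarrow> (\<Sum>j<q. f i j) = 0" "\<And>j. j < q \<Longrightarrow> (\<Sum>i<p. f i j) = 0"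
      "\<And>x. x \<in> S \<Longrightarrow> \<exists>i<p. \<exists>j<q. f i j = x"
    using assms(1) unfolding zero_sum_array_def by blast
  obtain g where g: "\<And>i. i < p \<Longrightarrow> (\<Sum>j<q'. g i j) = 0" "\<And>j. j < q' \<Longrightarrow> (\<Sum>i<p. g i j) = 0"
      "\<And>x. x \<in> T \<Longrightarrow> \<exists>i<p. \<exists>j<q'. g i j = x"
    using assms(2) unfolding zero_sum_array_def by blast
  define k where "k i j = (if j < q then f i j else g i (j - q))" for i j
  have "(\<Sum>j<q + q'. k i j) = 0" if "i < p" for i
    using f(1)[OF that] g(1)[OF that] by (simp add: sum_lessThan_split k_def)
  moreover have "(\<Sum>i<p. k i j) = 0" if "j < q + q'" for j
    using f(2)[of j] g(2)[of "j - q"] that by (cases "j < q") (simp_all add: k_def)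
  moreover have "\<exists>i<p. \<exists>j<q + q'. k i j = x" if x: "x \<in> S \<union> T" for x
  proof (cases "x \<in> S")
    case True
    then obtain i j where "i < p" "j < q" "f i j = x" using f(3) by blast
    then have "i < p" "j < q + q'" "k i j = x" by (simp_all add: k_def)
    then show ?thesis by blast
  next
    case False
    then obtain i j where "i < p" "j < q'" "g i j = x" using x g(3) by blast
    then have "i < p" "q + j < q + q'" "k i (q + j) = x" by (simp_all add: k_def)
    then show ?thesis by blast
  qed
  ultimately show ?thesis
    unfolding zero_sum_array_def by blast
qed

lemma zero_sum_array_above:
  assumes "zero_sum_array p q S" "zero_sum_array p' q T"
  shows "zero_sum_array (p + p') q (S \<union> T)"
  using assms by (blast intro: zero_sum_array_beside zero_sum_array_transpose)

text \<open>Serves for explicit arrays, written as lists of rows, whose sums are then checked by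
  simplification or evaluation.\<close>

lemma zero_sum_array_of_lists:
  assumes "length M = p" "\<forall>xs\<in>set M. length xs = q \<and> sum_list xs = 0"
    and "\<forall>j<q. (\<Sum>xs\<leftarrow>M. xs ! j) = 0"
  shows "zero_sum_array p q (set (concat M))"
  unfolding zero_sum_array_def
proof (rule exI[of _ "\<lambda>i j. M ! i ! j"], intro conjI allI impI ballI)
  fix i assume "i < p"
  then have "M ! i \<in> set M" using assms(1) by simp
  then have "length (M ! i) = q" "sum_list (M ! i) = 0" using assms(2) by auto
  then show "(\<Sum>j<q. M ! i ! j) = 0" by (simp add: sum_list_sum_nth atLeast0LessThan)
next
  fix j assume "j < q"
  then have "(\<Sum>xs\<leftarrow>M. xs ! j) = 0" using assms(3) by blast
  then show "(\<Sum>i<p. M ! i ! j) = 0"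
    using assms(1) by (simp add: sum_list_sum_nth atLeast0LessThan)
next
  fix x assume "x \<in> set (concat M)"
  then obtain xs where "xs \<in> set M" "x \<in> set xs" by auto
  then show "\<exists>i<p. \<exists>j<q. M ! i ! j = x"
    using assms(1,2) by (metis in_set_conv_nth)
qed

section \<open>Arrays with two even sides\<close>

text \<open>The first row cancels identically in \<open>a\<close> and \<open>s\<close>, so the block
  fits any four consecutive terms of a progression; the second row is its negative.\<close>

lemma zero_sum_array_shiftable_block:
  "zero_sum_array 2 4 (plus_minus ((\<lambda>k. a + s * int k) ` {..<4}))"
proof -
  let ?M = "[[a, - (a + s), - (a + 2 * s), a + 3 * s], [- a, a + s, a + 2 * s, - (a + 3 * s)]]"
  have "zero_sum_array 2 4 (set (concat ?M))"
    by (rule zero_sum_array_of_lists) (auto simp: numeral_eq_Suc less_Suc_eq)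
  then show ?thesis
    by (rule zero_sum_array_mono) (auto simp: plus_minus_def numeral_eq_Suc lessThan_Suc)
qed

lemma progression_split:
  "(\<lambda>k. a + s * int k) ` {..<x + y} =
   (\<lambda>k. a + s * int k) ` {..<x} \<union> (\<lambda>k. (a + s * int x) + s * int k) ` {..<y}"
proof -
  have "{..<x + y} = {..<x} \<union> (+) x ` {..<y}"
    using image_add_atLeastLessThan[of x 0 y] by (auto simp: atLeast0LessThan)
  then show ?thesis by (simp add: image_Un image_image algebra_simps)
qed

lemma zero_sum_array_two_rows:
  "zero_sum_array 2 (4 * l) (plus_minus ((\<lambda>k. a + s * int k) ` {..<4 * l}))"
proof (induction l)
  case 0
  then show ?case using zero_sum_array_empty[of 2] by (simp add: plus_minus_def)
next
  case (Suc l)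
  have eq: "4 * Suc l = 4 * l + 4" by simp
  from zero_sum_array_beside[OF Suc zero_sum_array_shiftable_block[of "a + s * int (4 * l)" s]]
  show ?case
    unfolding eq progression_split plus_minus_Un .
qed

lemma zero_sum_array_progression:
  "zero_sum_array (2 * k) (4 * l) (plus_minus ((\<lambda>j. a + s * int j) ` {..<4 * k * l}))"
proof (induction k)
  case 0
  then show ?case using zero_sum_array_transpose[OF zero_sum_array_empty[of "4 * l"]]
    by (simp add: plus_minus_def)
next
  case (Suc k)
  have eq: "4 * Suc k * l = 4 * k * l + 4 * l" "2 * Suc k = 2 * k + 2"
    by (simp_all add: algebra_simps)
  from zero_sum_array_above[OF Suc zero_sum_array_two_rows[of l "a + s * int (4 * k * l)" s]]
  show ?case
    unfolding eq progression_split plus_minus_Un .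
qed

text \<open>The free parameters allow two uses: step 2 for the odd numbers of a centered even
  rectangle, step 1 for the large consecutive numbers left over in odd rectangles.\<close>

lemma zero_sum_array_even:
  assumes "even p" "even q" "4 dvd p \<or> 4 dvd q"
  shows "zero_sum_array p q (plus_minus ((\<lambda>j. a + s * int j) ` {..<p * q div 2}))"
proof -
  have *: "zero_sum_array x y (plus_minus ((\<lambda>j. a + s * int j) ` {..<x * y div 2}))"
    if x: "even x" and y: "4 dvd y" for x y
  proof -
    obtain k where "x = 2 * k" using x by blast
    moreover obtain l where "y = 4 * l" using y unfolding dvd_def by blast
    ultimately show ?thesis using zero_sum_array_progression[of k l a s] by (simp add: algebra_simps)
  qed
  show ?thesis
    using assms *[of p q] zero_sum_array_transpose[OF *[of q p]] by (auto simp: mult.commute)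
qed

text \<open>If both sides are 2 modulo 4, the area is 4 modulo 8 and 2 by 4 blocks cannot tile.
  Removing one 2 by 6 corner leaves a 2 by \<open>q - 6\<close> and a \<open>p - 2\<close> by
  \<open>q\<close> rectangle, which they do tile.\<close>

lemma zero_sum_array_both_even:
  assumes "even p" "even q" "2 \<le> p" "6 \<le> q"
  shows "zero_sum_array p q (plus_minus ((\<lambda>j. 1 + 2 * int j) ` {..<p * q div 2}))"
proof (cases "4 dvd p \<or> 4 dvd q")
  case True
  then show ?thesis using assms zero_sum_array_even by blast
next
  case False
  then have "p mod 4 = 2" "q mod 4 = 2" using assms(1,2) by presburger+
  then have d: "4 dvd p - 2" "4 dvd q - 6" using assms(3,4) by presburger+
  let ?A = "\<lambda>a n. plus_minus ((\<lambda>j. a + 2 * int j) ` {..<n::nat})"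
  have base: "zero_sum_array 2 6 (?A 1 6)"
  proof -
    \<comment> \<open>The first six odd numbers add up to 36 and split as 11 + 7 = 9 + 5 + 3 +
      1.\<close>
    let ?M = "[[11, 7, -9, -5, -3, -1], [-11, -7, 9, 5, 3, 1 :: int]]"
    have "zero_sum_array 2 6 (set (concat ?M))"
      by (rule zero_sum_array_of_lists) (auto simp: numeral_eq_Suc less_Suc_eq)
    then show ?thesis
      by (rule zero_sum_array_mono) (auto simp: plus_minus_def numeral_eq_Suc lessThan_Suc)
  qed
  have "zero_sum_array 2 (q - 6) (?A (1 + 2 * int 6) (q - 6))"
    using zero_sum_array_even[of 2 "q - 6"] assms d by auto
  from zero_sum_array_beside[OF base this]
  have "zero_sum_array 2 (6 + (q - 6)) (?A 1 (6 + (q - 6)))"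
    unfolding progression_split plus_minus_Un .
  then have top: "zero_sum_array 2 q (?A 1 q)" using assms(4) by simp
  have "zero_sum_array (p - 2) q (?A (1 + 2 * int q) ((p - 2) * q div 2))"
    using zero_sum_array_even[of "p - 2" q] assms d by auto
  from zero_sum_array_above[OF top this]
  have "zero_sum_array (2 + (p - 2)) q (?A 1 (q + (p - 2) * q div 2))"
    unfolding progression_split plus_minus_Un .
  then have "zero_sum_array p q (?A 1 (q + (p - 2) * q div 2))"
    using le_add_diff_inverse[OF assms(3)] by simp
  moreover have "q + (p - 2) * q div 2 = p * q div 2"
  proof -
    obtain k where "p = 2 * k" using assms(1) by blast
    moreover from this obtain l where "k = Suc l" using assms(3) by (cases k) auto
    ultimately show ?thesis by simp
  qed
  ultimately show ?thesis by simp
qed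

section \<open>Arrays with two odd sides\<close>

text \<open>Each triple contributes the column \<open>(a, b, -c)\<close> and its negative, so
  columns vanish by \<open>a + b = c\<close> and rows cancel in pairs.\<close>

lemma zero_sum_array_triples:
  assumes "finite I" "\<And>i. i \<in> I \<Longrightarrow> a i + b i = (c i :: int)"
  shows "zero_sum_array 3 (2 * card I) (plus_minus (\<Union>i\<in>I. {a i, b i, c i}))"
  using assms
proof (induction I rule: finite_induct)
  case empty
  then show ?case using zero_sum_array_empty[of 3] by (simp add: plus_minus_def)
next
  case (insert x I)
  let ?M = "[[a x, - a x], [b x, - b x], [- c x, c x]]"
  have "zero_sum_array 3 2 (set (concat ?M))"
    using insert.prems[of x]
    by (intro zero_sum_array_of_lists) (auto simp: numeral_eq_Suc less_Suc_eq)
  then have "zero_sum_array 3 2 (plus_minus {a x, b x, c x})"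
    by (rule zero_sum_array_mono) (auto simp: plus_minus_def)
  from zero_sum_array_beside[OF this insert.IH] insert show ?case
    by (simp flip: plus_minus_Un)
qed

text \<open>
  The column \<open>(-v, 0, v)\<close> is balanced by the triples \<open>(2i, v - i, v + i)\<close> with \<open>i = 1, 2, 3\<close>: the
  columns of such a triple and of its negative, with two entries exchanged, contribute
  \<open>v + 3\<close>, \<open>-(v - 6)\<close> and \<open>v - 9\<close> to the first row.
\<close>

lemma zero_sum_array_core:
  "zero_sum_array 3 7 ({0} \<union> plus_minus {v, 2, v - 1, v + 1, 4, v - 2, v + 2, 6, v - 3, v + 3})"
proof -
  let ?M = "[[-v, v - 3, -6, 2, v + 1, 4, -(v - 2)],
             [0, -(v + 3), v + 3, v - 1, -(v - 1), -(v + 2), v + 2],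
             [v, 6, -(v - 3), -(v + 1), -2, v - 2, -4]]"
  have "zero_sum_array 3 7 (set (concat ?M))"
    by (rule zero_sum_array_of_lists) (auto simp: numeral_eq_Suc less_Suc_eq)
  then show ?thesis
    by (rule zero_sum_array_mono) (auto simp: plus_minus_def)
qed

text \<open>These sizes are too small for the general construction, whose core needs the differences
  2, 4 and 6 to be available.\<close>

lemma zero_sum_array_small:
  "zero_sum_array 3 5 {-7..7}"
  "zero_sum_array 3 7 {-10..10}"
  "zero_sum_array 3 9 {-13..13}"
  "zero_sum_array 3 11 {-16..16}"
  "zero_sum_array 5 7 {-17..17}"
  "zero_sum_array 5 9 {-22..22}"
proof -
  have *: "zero_sum_array p q {-x..x}"
    if "length M = p" "\<forall>xs\<in>set M. length xs = q \<and> sum_list xs = 0"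
      "\<forall>j<q. (\<Sum>xs\<leftarrow>M. xs ! j) = 0" "set [-x..x] \<subseteq> set (concat M)" for p q x M
    using zero_sum_array_mono[OF zero_sum_array_of_lists[OF that(1-3)], of "{-x..x}"] that(4) by simp
  show "zero_sum_array 3 5 {-7..7}"
    by (rule *[where M = "[[6, 2, -4, -3, -1], [-7, -5, 0, 5, 7], [1, 3, 4, -2, -6]]"]; code_simp)
  show "zero_sum_array 3 7 {-10..10}"
    by (rule *[where M = "[[6, 9, -2, -3, -7, 1, -4], [-10, -8, -5, 0, 5, 8, 10],
      [4, -1, 7, 3, 2, -9, -6]]"]; code_simp)
  show "zero_sum_array 3 9 {-13..13}"
    by (rule *[where M = "[[-2, -8, 6, -12, 5, -3, 10, -7, 11], [13, 1, 4, 9, 0, -9, -4, -1, -13],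
      [-11, 7, -10, 3, -5, 12, -6, 8, 2]]"]; code_simp)
  show "zero_sum_array 3 11 {-16..16}"
    by (rule *[where M = "[[15, -14, -10, -2, 16, -8, 5, -9, -4, -1, 12],
      [-3, 13, 6, -7, -11, 0, 11, 7, -6, -13, 3], [-12, 1, 4, 9, -5, 8, -16, 2, 10, 14, -15]]"];
      code_simp)
  show "zero_sum_array 5 7 {-17..17}"
    by (rule *[where M = "[[6, -2, -7, -16, 12, 15, -8], [5, 14, -11, 3, -17, -4, 10],
      [-9, -1, 13, 0, -13, 1, 9], [-10, 4, 17, -3, 11, -14, -5], [8, -15, -12, 16, 7, 2, -6]]"];
      code_simp)
  show "zero_sum_array 5 9 {-22..22}"
    by (rule *[where M = "[[-9, -15, 6, -2, 3, 22, 18, -13, -10],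
      [-14, 19, -7, 21, -16, 8, 1, 5, -17], [-4, -12, 20, 11, 0, -11, -20, 12, 4],
      [17, -5, -1, -8, 16, -21, 7, -19, 14], [10, 13, -18, -22, -3, 2, -6, 15, 9]]"]; code_simp)
qed

text \<open>The triples are shared out between the arm to the right of the 3 by 7 core and the
  transposed arm below its first three columns.\<close>

lemma zero_sum_array_arms:
  assumes "finite I" "\<And>i. i \<in> I \<Longrightarrow> a i + b i = (c i :: int)" "card I = x + y"
  obtains S T where "zero_sum_array 3 (2 * x) S" "zero_sum_array (2 * y) 3 T"
    "plus_minus (\<Union>i\<in>I. {a i, b i, c i}) = S \<union> T"
proof -
  obtain J where J: "J \<subseteq> I" "card J = x"
    using obtain_subset_with_card_n[of x I] assms(3) by auto
  then have "finite J" "card (I - J) = y" "I = J \<union> (I - J)"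
    using assms(1,3) by (auto simp: card_Diff_subset finite_subset)
  moreover have "zero_sum_array 3 (2 * card J) (plus_minus (\<Union>i\<in>J. {a i, b i, c i}))"
    using assms J(1) \<open>finite J\<close> by (intro zero_sum_array_triples) auto
  moreover have "zero_sum_array 3 (2 * card (I - J)) (plus_minus (\<Union>i\<in>I - J. {a i, b i, c i}))"
    using assms by (intro zero_sum_array_triples) auto
  ultimately show ?thesis
    using that[of "plus_minus (\<Union>i\<in>J. {a i, b i, c i})" "plus_minus (\<Union>i\<in>I - J. {a i, b i, c i})"]
      J(2) zero_sum_array_transpose by (metis UN_Un plus_minus_Un)
qed

text \<open>
  The middle term of the triple \<open>i + mid h u i = c\<close>, where \<open>u\<close> is the number of odd differences; the
  even ones are nested around \<open>v = 2h + u + 1\<close>.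
\<close>

definition mid :: "nat \<Rightarrow> nat \<Rightarrow> nat \<Rightarrow> int" where
  "mid h u i = (if even i then 2 * int h + int u + 1 - int i div 2
                else int h + int u + 1 - (int i + 1) div 2)"

text \<open>The difference \<open>2k - 1\<close> belongs to the pair \<open>h + u + 1 - k\<close>,
  \<open>h + u + k\<close>; for \<open>k = 1, ..., u\<close> these fill \<open>h + 1\<close> to
  \<open>h + 2u\<close>. The difference \<open>2k\<close> belongs to \<open>v - k\<close>,
  \<open>v + k\<close> with \<open>v = 2h + u + 1\<close>; since \<open>h = u + w\<close>, these and
  \<open>v\<close> fill the rest up to \<open>3h + 1\<close>.\<close>

lemma nested_pairs_cover:
  assumes "h = u + w" "int h < z" "z \<le> 3 * int h + 1"
  shows "z = 2 * int h + int u + 1 \<or>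
    (\<exists>i\<ge>1. i \<le> (if even i then 2 * w else 2 * u) \<and> (z = mid h u i \<or> z = int i + mid h u i))"
proof -
  define v where "v = 2 * int h + int u + 1"
  have odd_mid: "mid h u (2 * k - 1) = int h + int u + 1 - int k" if "1 \<le> k" for k
    using that unfolding mid_def by (auto simp: of_nat_diff)
  have even_mid: "mid h u (2 * k) = v - int k" for k
    unfolding mid_def v_def by simp
  consider "z \<le> int h + int u" | "int h + int u < z" "z \<le> int h + 2 * int u"
    | "int h + 2 * int u < z" "z < v" | "z = v" | "v < z" by linarith
  then show ?thesis
  proof cases
    case 1
    then show ?thesis using assms odd_mid[of "nat (int h + int u + 1 - z)"]
      by (intro disjI2 exI[of _ "2 * nat (int h + int u + 1 - z) - 1"]) auto
  next
    case 2
    then show ?thesis using assms odd_mid[of "nat (z - int h - int u)"]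
      by (intro disjI2 exI[of _ "2 * nat (z - int h - int u) - 1"]) (auto simp: of_nat_diff)
  next
    case 3
    then show ?thesis using assms even_mid[of "nat (v - z)"] unfolding v_def
      by (intro disjI2 exI[of _ "2 * nat (v - z)"]) (auto simp: v_def)
  next
    case 4
    then show ?thesis by (simp add: v_def)
  next
    case 5
    then show ?thesis using assms even_mid[of "nat (z - v)"] unfolding v_def
      by (intro disjI2 exI[of _ "2 * nat (z - v)"]) (auto simp: v_def)
  qed
qed

text \<open>The 3 by 7 core and the two arms absorb \<open>0\<close> and all absolute values up to
  \<open>3h + 1\<close>. The remaining \<open>y (4 + 2x)\<close> values fill the \<open>2y\<close>
  by \<open>4 + 2x\<close> corner, which has a side divisible by 4 exactly when \<open>x\<close> or
  \<open>y\<close> is even.\<close>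

lemma zero_sum_array_odd_generic:
  fixes x y :: nat
  assumes xy: "3 \<le> x + y" and ev: "even x \<or> even y"
  shows "zero_sum_array (3 + 2 * y) (7 + 2 * x)
    ({0} \<union> plus_minus {1..int (10 + 3 * x + 7 * y + 2 * x * y)})"
proof -
  define h where "h = x + y + 3"
  \<comment> \<open>The number of odd differences among \<open>1, ..., h\<close>.\<close>
  define u where "u = (h + 1) div 2"
  define v where "v = 2 * int h + int u + 1"
  \<comment> \<open>The triples with differences 2, 4 and 6 are \<open>(2, v - 1, v + 1)\<close>,
    \<open>(4, v - 2, v + 2)\<close> and \<open>(6, v - 3, v + 3)\<close>; they are already used in
    the core.\<close>
  define I where "I = {1..h} - {2, 4, 6}"
  define K where "K = {v, 2, v - 1, v + 1, 4, v - 2, v + 2, 6, v - 3, v + 3}"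
  define L where "L = (\<Union>i\<in>I. {int i, mid h u i, int i + mid h u i})"
  define B where "B = (\<lambda>j. (3 * int h + 2) + 1 * int j) ` {..<(2 * y) * (4 + 2 * x) div 2}"
  have "card I = x + y"
    unfolding I_def using xy by (subst card_Diff_subset) (auto simp: h_def)
  then obtain S T where ST: "zero_sum_array 3 (2 * x) S" "zero_sum_array (2 * y) 3 T"
      "plus_minus L = S \<union> T"
    unfolding L_def
    using zero_sum_array_arms[of I int "mid h u" "\<lambda>i. int i + mid h u i" x y] by (auto simp: I_def)
  have top: "zero_sum_array 3 (7 + 2 * x) (({0} \<union> plus_minus K) \<union> S)"
    unfolding K_def by (intro zero_sum_array_beside zero_sum_array_core ST)
  have "zero_sum_array (2 * y) (4 + 2 * x) (plus_minus B)"
    unfolding B_def using ev by (intro zero_sum_array_even) auto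
  from zero_sum_array_beside[OF ST(2) this]
  have bottom: "zero_sum_array (2 * y) (7 + 2 * x) (T \<union> plus_minus B)" by (simp add: algebra_simps)
  have "{1..int (10 + 3 * x + 7 * y + 2 * x * y)} \<subseteq> K \<union> L \<union> B"
  proof
    fix z assume z: "z \<in> {1..int (10 + 3 * x + 7 * y + 2 * x * y)}"
    have small: "z \<in> K \<union> L" if "i \<in> {1..h}" "z \<in> {int i, mid h u i, int i + mid h u i}" for i
    proof (cases "i \<in> I")
      case True
      then show ?thesis using that unfolding L_def by blast
    next
      case False
      then have "i = 2 \<or> i = 4 \<or> i = 6" using that unfolding I_def by blast
      then show ?thesis using that(2) unfolding K_def v_def mid_def by auto
    qed
    consider "z \<le> int h" | "int h < z" "z \<le> 3 * int h + 1" | "3 * int h + 1 < z" by linarith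
    then show "z \<in> K \<union> L \<union> B"
    proof cases
      case 1
      then show ?thesis using z small[of "nat z"] by (auto simp: nat_le_iff)
    next
      case 2
      have "h = u + h div 2" unfolding u_def by presburger
      from nested_pairs_cover[OF this 2]
      consider "z = v" | i where "1 \<le> i" "i \<le> (if even i then 2 * (h div 2) else 2 * u)"
          "z = mid h u i \<or> z = int i + mid h u i"
        unfolding v_def by blast
      then show ?thesis
      proof cases
        case 1
        then show ?thesis by (simp add: K_def)
      next
        case (2 i)
        then have "i \<in> {1..h}" unfolding u_def by (cases "even i") (simp, simp, presburger)
        then show ?thesis using 2(3) small[of i] by blast
      qed
    next
      case 3
      have eq: "2 * y * (4 + 2 * x) div 2 = 4 * y + 2 * x * y" by (simp add: algebra_simps)
      have "z - (3 * int h + 2) < 4 * int y + 2 * int x * int y"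
        using z unfolding h_def by (simp add: algebra_simps)
      then have "nat (z - (3 * int h + 2)) < 4 * y + 2 * x * y"
        using 3 by (simp add: nat_less_iff)
      then have "z \<in> B"
        using 3 unfolding B_def eq by (intro image_eqI[of _ _ "nat (z - (3 * int h + 2))"]) auto
      then show ?thesis by blast
    qed
  qed
  then have "plus_minus {1..int (10 + 3 * x + 7 * y + 2 * x * y)} \<subseteq> plus_minus K \<union> S \<union> T \<union> plus_minus B"
    using ST(3) plus_minus_mono by (metis plus_minus_Un sup_assoc)
  then show ?thesis
    by (intro zero_sum_array_mono[OF zero_sum_array_above[OF top bottom]]) auto
qed

text \<open>
  The region outside the two arms has both sides congruent to 2 modulo 4, so \<open>2 \<times> 4\<close> blocks do not
  tile it. Using the differences \<open>1, \<dots>, h - 1, h + 1\<close> instead, the number \<open>h\<close> fails its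
  triple by one, which the consecutive numbers \<open>3h+2, 3h+3\<close> compensate in a \<open>2 \<times> 5\<close> strip.
\<close>

lemma zero_sum_array_odd_exceptional:
  fixes x y :: nat
  assumes xy: "4 \<le> x + y" and odds: "odd x" "odd y"
  shows "zero_sum_array (3 + 2 * y) (7 + 2 * x)
    ({0} \<union> plus_minus {1..int (10 + 3 * x + 7 * y + 2 * x * y)})"
proof -
  define h where "h = x + y + 3"
  \<comment> \<open>As \<open>h\<close> is odd, replacing the difference \<open>h\<close> by
    \<open>h + 1\<close> leaves the odd differences \<open>1, ..., h - 2\<close> and the even ones
    \<open>2, ..., h + 1\<close>.\<close>
  define u where "u = (h - 1) div 2"
  define v where "v = 2 * int h + int u + 1"
  define I where "I = {1..<h} - {2, 4, 6}"
  define K where "K = {v, 2, v - 1, v + 1, 4, v - 2, v + 2, 6, v - 3, v + 3}"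
  define L where "L = (\<Union>i\<in>I. {int i, mid h u i, int i + mid h u i})"
  define F where "F = {int h, mid h u (h + 1), int (h + 1) + mid h u (h + 1), 3 * int h + 2, 3 * int h + 3}"
  \<comment> \<open>The 2 by 5 strip is completed to full width by a 2 by \<open>2 + 2x\<close>
    piece. Only \<open>y - 1\<close> triples go into the lower arm, next to a
    \<open>2 (y - 1)\<close> by \<open>4 + 2x\<close> rectangle. For odd \<open>x\<close> and
    \<open>y\<close> both pieces have a side divisible by 4.\<close>
  define B where "B = (\<lambda>j. (3 * int h + 4) + 1 * int j) ` {..<(2 + 2 * x) + (2 * (y - 1)) * (4 + 2 * x) div 2}"
  define B1 where "B1 = (\<lambda>j. (3 * int h + 4) + 1 * int j) ` {..<2 + 2 * x}"
  define B2 where "B2 = (\<lambda>j. (3 * int h + 4 + 1 * int (2 + 2 * x)) + 1 * int j) ` {..<(2 * (y - 1)) * (4 + 2 * x) div 2}"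
  have B: "B = B1 \<union> B2" unfolding B_def B1_def B2_def by (rule progression_split)
  have y: "1 \<le> y" using odds by (cases y) auto
  have h: "odd h" using odds unfolding h_def by simp
  have "card I = x + (y - 1)"
    unfolding I_def using xy y by (subst card_Diff_subset) (auto simp: h_def)
  then obtain S T where ST: "zero_sum_array 3 (2 * x) S" "zero_sum_array (2 * (y - 1)) 3 T"
      "plus_minus L = S \<union> T"
    unfolding L_def
    using zero_sum_array_arms[of I int "mid h u" "\<lambda>i. int i + mid h u i" x "y - 1"] by (auto simp: I_def)
  have top: "zero_sum_array 3 (7 + 2 * x) (({0} \<union> plus_minus K) \<union> S)"
    unfolding K_def by (intro zero_sum_array_beside zero_sum_array_core ST)
  have five: "zero_sum_array 2 5 (plus_minus F)"
  proof -
    define s t where "s = int h" and "t = mid h u (h + 1)"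
    let ?M = "[[s, t, - (s + 1 + t), - (3 * s + 2), 3 * s + 3],
               [- s, - t, s + 1 + t, 3 * s + 2, - (3 * s + 3)]]"
    have "zero_sum_array 2 5 (set (concat ?M))"
      by (rule zero_sum_array_of_lists) (auto simp: numeral_eq_Suc less_Suc_eq)
    then show ?thesis
      by (rule zero_sum_array_mono) (auto simp: plus_minus_def F_def s_def t_def)
  qed
  have "4 dvd 2 + 2 * x" "4 dvd 2 * (y - 1)" using odds by presburger+
  then have "zero_sum_array 2 (2 + 2 * x) (plus_minus B1)"
      "zero_sum_array (2 * (y - 1)) (4 + 2 * x) (plus_minus B2)"
    using zero_sum_array_even[of 2 "2 + 2 * x" "3 * int h + 4" 1] unfolding B1_def B2_def
    by (simp, intro zero_sum_array_even) simp_all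
  then have "zero_sum_array (2 + 2 * (y - 1)) (7 + 2 * x)
      ((plus_minus F \<union> plus_minus B1) \<union> (T \<union> plus_minus B2))"
    using zero_sum_array_beside[OF five, of "2 + 2 * x"] zero_sum_array_beside[OF ST(2), of "4 + 2 * x"]
    by (intro zero_sum_array_above) simp_all
  then have bottom: "zero_sum_array (2 * y) (7 + 2 * x)
      ((plus_minus F \<union> plus_minus B1) \<union> (T \<union> plus_minus B2))"
  proof -
    have "2 + 2 * (y - 1) = 2 * y" using y by simp
    then show ?thesis using \<open>zero_sum_array (2 + 2 * (y - 1)) (7 + 2 * x) _\<close> by (simp only:)
  qed
  have "{1..int (10 + 3 * x + 7 * y + 2 * x * y)} \<subseteq> K \<union> L \<union> F \<union> B"
  proof
    fix z assume z: "z \<in> {1..int (10 + 3 * x + 7 * y + 2 * x * y)}"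
    have small: "z \<in> K \<union> L" if "i \<in> {1..<h}" "z \<in> {int i, mid h u i, int i + mid h u i}" for i
    proof (cases "i \<in> I")
      case True
      then show ?thesis using that unfolding L_def by blast
    next
      case False
      then have "i = 2 \<or> i = 4 \<or> i = 6" using that unfolding I_def by blast
      then show ?thesis using that(2) unfolding K_def v_def mid_def by auto
    qed
    consider "z < int h" | "z = int h" | "int h < z" "z \<le> 3 * int h + 1"
      | "z = 3 * int h + 2" | "z = 3 * int h + 3" | "3 * int h + 4 \<le> z" by linarith
    then show "z \<in> K \<union> L \<union> F \<union> B"
    proof cases
      case 1
      then show ?thesis using z small[of "nat z"] by (auto simp: nat_less_iff Suc_le_eq)
    next
      case 3
      have "h = u + (h + 1) div 2" unfolding u_def using h by presburger
      from nested_pairs_cover[OF this 3]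
      consider "z = v" | i where "1 \<le> i" "i \<le> (if even i then 2 * ((h + 1) div 2) else 2 * u)"
          "z = mid h u i \<or> z = int i + mid h u i"
        unfolding v_def by blast
      then show ?thesis
      proof cases
        case 1
        then show ?thesis by (simp add: K_def)
      next
        case i: (2 i)
        have "i < h \<or> i = h + 1"
        proof (cases "even i")
          case True
          then have "i \<le> 2 * ((h + 1) div 2)" using i(2) by simp
          then show ?thesis using True h by presburger
        next
          case False
          then have "i \<le> 2 * ((h - 1) div 2)" using i(2) unfolding u_def by simp
          then show ?thesis using i(1) by linarith
        qed
        then show ?thesis using i small[of i] unfolding F_def by auto
      qed
    next
      case 6
      obtain w where w: "y = Suc w" using y by (cases y) auto
      have eq: "(2 + 2 * x) + 2 * (y - 1) * (4 + 2 * x) div 2 = 2 + 2 * x + 4 * w + 2 * x * w"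
        unfolding w by (simp add: algebra_simps)
      have "z - (3 * int h + 4) < int (2 + 2 * x + 4 * w + 2 * x * w)"
        using z unfolding h_def w by (simp add: algebra_simps)
      then have "nat (z - (3 * int h + 4)) < 2 + 2 * x + 4 * w + 2 * x * w"
        using 6 by (simp add: nat_less_iff)
      then have "z \<in> B"
        using 6 unfolding B_def eq by (intro image_eqI[of _ _ "nat (z - (3 * int h + 4))"]) auto
      then show ?thesis by blast
    qed (simp_all add: F_def)
  qed
  then have "plus_minus {1..int (10 + 3 * x + 7 * y + 2 * x * y)} \<subseteq>
      plus_minus K \<union> S \<union> T \<union> plus_minus F \<union> plus_minus B1 \<union> plus_minus B2"
    using ST(3) B plus_minus_mono by (metis plus_minus_Un sup_assoc)
  then show ?thesis
    by (intro zero_sum_array_mono[OF zero_sum_array_above[OF top bottom]]) auto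
qed

lemma zero_sum_array_both_odd:
  assumes "odd p" "odd q" "3 \<le> p" "p < q"
  shows "zero_sum_array p q {- int (p * q div 2)..int (p * q div 2)}"
proof (cases "q = 5")
  case True
  then have "p = 3" using assms by presburger
  then show ?thesis using True zero_sum_array_small by simp
next
  case False
  then have "7 \<le> q" using assms by presburger
  then obtain x where q: "q = 7 + 2 * x" using assms(2) by (metis add.commute dvd_def le_Suc_ex even_add odd_numeral)
  obtain y where p: "p = 3 + 2 * y" using assms(1,3) by (metis dvd_def le_Suc_ex even_add odd_numeral)
  have n: "p * q div 2 = 10 + 3 * x + 7 * y + 2 * x * y" unfolding p q by (simp add: algebra_simps)
  show ?thesis
  proof (cases "x + y < 3")
    case True
    \<comment> \<open>The remaining pair \<open>x = 0\<close>, \<open>y = 2\<close> would be the 7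
      by 7 square, excluded by \<open>p < q\<close>.\<close>
    then have "x = 0 \<and> y = 0 \<or> x = 1 \<and> y = 0 \<or> x = 2 \<and> y = 0 \<or> x = 0 \<and> y = 1 \<or> x = 1 \<and> y = 1"
      using assms(4) unfolding p q by presburger
    then show ?thesis using zero_sum_array_small unfolding n by (auto simp: p q)
  next
    case False
    have "zero_sum_array p q ({0} \<union> plus_minus {1..int (10 + 3 * x + 7 * y + 2 * x * y)})"
    proof (cases "even x \<or> even y")
      case True
      then show ?thesis using False zero_sum_array_odd_generic[of x y] unfolding p q by simp
    next
      case odds: False
      then have "4 \<le> x + y" using False by presburger
      then show ?thesis using odds zero_sum_array_odd_exceptional[of x y] unfolding p q by simp
    qed
    moreover have "{- int n..int n} \<subseteq> {0} \<union> plus_minus {1..int n}" for n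
      by (auto simp: plus_minus_iff)
    ultimately show ?thesis unfolding n using zero_sum_array_mono by blast
  qed
qed

section \<open>Magic rectangles\<close>

text \<open>Centering sends \<open>k\<close> to \<open>2k - (pq + 1)\<close>, doubled to stay in the
  integers; undoing it turns zero sums into constant ones.\<close>

lemma magic_rectangle_of_zero_sum_array:
  assumes "zero_sum_array p q ((\<lambda>k. 2 * int k - int (p * q + 1)) ` {1..p * q})"
  obtains M where "bij_betw (\<lambda>(i, j). M i j) ({..<p} \<times> {..<q}) {1..p * q}"
    "\<And>i. i < p \<Longrightarrow> 2 * (\<Sum>j<q. M i j) = q * (p * q + 1)"
    "\<And>j. j < q \<Longrightarrow> 2 * (\<Sum>i<p. M i j) = p * (p * q + 1)"
proof -
  define n where "n = p * q"
  obtain f where f: "\<forall>i<p. (\<Sum>j<q. f i j) = 0" "\<forall>j<q. (\<Sum>i<p. f i j) = 0"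
      "\<forall>x\<in>(\<lambda>k. 2 * int k - int (n + 1)) ` {1..n}. \<exists>i<p. \<exists>j<q. f i j = x"
    using assms unfolding zero_sum_array_def n_def by (elim exE conjE)
  define D where "D = {..<p} \<times> {..<q}"
  define V where "V = (\<lambda>k. 2 * int k - int (n + 1)) ` {1..n}"
  have "V \<subseteq> (\<lambda>(i, j). f i j) ` D"
  proof
    fix x assume "x \<in> V"
    then obtain i j where "i < p" "j < q" "f i j = x" using f(3) unfolding V_def by blast
    then show "x \<in> (\<lambda>(i, j). f i j) ` D" unfolding D_def by (intro image_eqI[of _ _ "(i, j)"]) auto
  qed
  moreover have "card V = n" unfolding V_def by (subst card_image) (auto simp: inj_on_def)
  moreover have "card D = n" "finite D" unfolding D_def n_def by simp_all
  \<comment> \<open>There are as many cells as prescribed values, so no other value occurs and none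
    is repeated.\<close>
  ultimately have im: "(\<lambda>(i, j). f i j) ` D = V"
    by (metis card_image_le card_subset_eq card_seteq finite_imageI)
  then have inj: "inj_on (\<lambda>(i, j). f i j) D"
    using \<open>card V = n\<close> \<open>card D = n\<close> \<open>finite D\<close> by (intro eq_card_imp_inj_on) auto
  define M where "M i j = nat ((f i j + int (n + 1)) div 2)" for i j
  have inD: "f i j = 2 * int (M i j) - int (n + 1) \<and> M i j \<in> {1..n}" if "i < p" "j < q" for i j
  proof -
    have "f i j \<in> V" using that im unfolding D_def by force
    then obtain k where "k \<in> {1..n}" "f i j = 2 * int k - int (n + 1)" unfolding V_def by blast
    moreover from this have "M i j = k" unfolding M_def by simp
    ultimately show ?thesis by simp
  qed
  have "inj_on (\<lambda>(i, j). M i j) D"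
  proof (rule inj_onI)
    fix a b assume ab: "a \<in> D" "b \<in> D" "(\<lambda>(i, j). M i j) a = (\<lambda>(i, j). M i j) b"
    then have "(\<lambda>(i, j). f i j) a = (\<lambda>(i, j). f i j) b"
      using inD unfolding D_def by (auto split: prod.splits)
    then show "a = b" using inj ab by (meson inj_onD)
  qed
  moreover have "(\<lambda>(i, j). M i j) ` D \<subseteq> {1..n}" using inD unfolding D_def by fastforce
  ultimately have bij: "bij_betw (\<lambda>(i, j). M i j) D {1..n}"
    using \<open>card D = n\<close> by (simp add: bij_betw_def card_image card_subset_eq)
  have row: "2 * (\<Sum>j<q. M i j) = q * (n + 1)" if i: "i < p" for i
  proof -
    have "(\<Sum>j<q. f i j) = (\<Sum>j<q. 2 * int (M i j) - int (n + 1))"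
      using inD i by (intro sum.cong) auto
    then have "int (2 * (\<Sum>j<q. M i j)) = int (q * (n + 1))"
      using f(1) i by (simp add: sum_subtractf sum_distrib_left distrib_left)
    then show ?thesis by (simp only: of_nat_eq_iff)
  qed
  have col: "2 * (\<Sum>i<p. M i j) = p * (n + 1)" if j: "j < q" for j
  proof -
    have "(\<Sum>i<p. f i j) = (\<Sum>i<p. 2 * int (M i j) - int (n + 1))"
      using inD j by (intro sum.cong) auto
    then have "int (2 * (\<Sum>i<p. M i j)) = int (p * (n + 1))"
      using f(2) j by (simp add: sum_subtractf sum_distrib_left distrib_left)
    then show ?thesis by (simp only: of_nat_eq_iff)
  qed
  show ?thesis
    using that bij row col unfolding D_def n_def by blast
qed

lemma magic_rectangle_exists:
  fixes p q :: nat
  assumes "2 \<le> p" "p < q" "even p \<longleftrightarrow> even q" "5 \<le> q"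
  obtains M where "bij_betw (\<lambda>(i, j). M i j) ({..<p} \<times> {..<q}) {1..p * q}"
    "\<And>i. i < p \<Longrightarrow> 2 * (\<Sum>j<q. M i j) = q * (p * q + 1)"
    "\<And>j. j < q \<Longrightarrow> 2 * (\<Sum>i<p. M i j) = p * (p * q + 1)"
proof -
  have "zero_sum_array p q ((\<lambda>k. 2 * int k - int (p * q + 1)) ` {1..p * q})"
  proof (cases "even p")
    case True
    \<comment> \<open>For even \<open>p * q\<close> the centered values are the odd numbers of
      absolute value below \<open>p * q\<close>.\<close>
    then have "zero_sum_array p q (plus_minus ((\<lambda>j. 1 + 2 * int j) ` {..<p * q div 2}))"
      using assms by (intro zero_sum_array_both_even) presburger+
    moreover obtain n where n: "p * q = 2 * n" using True by (auto elim!: evenE)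
    have "2 * int k - int (p * q + 1) \<in> plus_minus ((\<lambda>j. 1 + 2 * int j) ` {..<p * q div 2})"
      if "k \<in> {1..p * q}" for k
    proof (cases "k \<le> n")
      case True
      then have "- (2 * int k - int (p * q + 1)) = 1 + 2 * int (n - k)" "n - k < p * q div 2"
        using that n by auto
      then show ?thesis unfolding plus_minus_iff by (metis image_eqI lessThan_iff)
    next
      case False
      then have "2 * int k - int (p * q + 1) = 1 + 2 * int (k - n - 1)" "k - n - 1 < p * q div 2"
        using that n by auto
      then show ?thesis unfolding plus_minus_iff by (metis image_eqI lessThan_iff)
    qed
    ultimately show ?thesis by (blast intro: zero_sum_array_mono)
  next
    case False
    then have "zero_sum_array p q {- int (p * q div 2)..int (p * q div 2)}"
      using assms by (intro zero_sum_array_both_odd) presburger+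
    then obtain f where f: "\<forall>i<p. (\<Sum>j<q. f i j) = 0" "\<forall>j<q. (\<Sum>i<p. f i j) = 0"
        "\<forall>x\<in>{- int (p * q div 2)..int (p * q div 2)}. \<exists>i<p. \<exists>j<q. f i j = x"
      unfolding zero_sum_array_def by (elim exE conjE)
    obtain n where n: "p * q = 2 * n + 1" using False assms(3) by (metis even_mult_iff oddE)
    \<comment> \<open>For odd \<open>p * q\<close> the centered values are all even, so the array on
      \<open>-n, ..., n\<close> is doubled.\<close>
    have "\<exists>i<p. \<exists>j<q. 2 * f i j = 2 * int k - int (p * q + 1)" if "k \<in> {1..p * q}" for k
    proof -
      have "int k - int n - 1 \<in> {- int (p * q div 2)..int (p * q div 2)}" using that n by auto
      then obtain i j where "i < p" "j < q" "f i j = int k - int n - 1" using f(3) by blast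
      then show ?thesis using n by (intro exI[of _ i] exI[of _ j] conjI) simp_all
    qed
    then show ?thesis
      unfolding zero_sum_array_def using f(1,2)
      by (intro exI[of _ "\<lambda>i j. 2 * f i j"]) (auto simp flip: sum_distrib_left)
  qed
  then show ?thesis using that magic_rectangle_of_zero_sum_array by blast
qed

section \<open>Joins with edgeless graphs\<close>

lemma simple_graph_edge:
  assumes "simple_graph G" "{u, v} \<in> edges G"
  shows "u \<in> verts G" "v \<in> verts G" "u \<noteq> v"
  using assms unfolding simple_graph_def by (auto simp: card_insert_if)

lemma finite_edges:
  assumes "simple_graph G"
  shows "finite (edges G)"
  using assms unfolding simple_graph_def by (auto intro: finite_subset[of _ "Pow (verts G)"])

lemma degree_less_order:
  assumes G: "simple_graph G" and v: "v \<in> verts G"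
  shows "degree G v < card (verts G)"
proof -
  have fin: "finite (verts G)" using G unfolding simple_graph_def by blast
  have "{e \<in> edges G. v \<in> e} \<subseteq> (\<lambda>u. {v, u}) ` (verts G - {v})"
  proof
    fix e assume "e \<in> {e \<in> edges G. v \<in> e}"
    then have e: "v \<in> e" "e \<subseteq> verts G" "card e = 2" using G unfolding simple_graph_def by auto
    then obtain u where "e = {v, u}" "u \<noteq> v" by (metis card_2_iff doubleton_eq_iff insert_iff singletonD)
    then show "e \<in> (\<lambda>u. {v, u}) ` (verts G - {v})" using e by blast
  qed
  then have "degree G v \<le> card (verts G - {v})"
    unfolding degree_def using fin by (meson card_image_le card_mono finite_Diff finite_imageI le_trans)
  then show ?thesis using fin v by (metis card_Diff1_less le_less_trans)
qed

text \<open>Renumbering the colors by an initial segment makes this applicable to vertex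
  sums.\<close>

lemma chromatic_number_le_card_colors:
  assumes G: "simple_graph G" and c: "\<And>u v. {u, v} \<in> edges G \<Longrightarrow> c u \<noteq> c v"
    and k: "card (c ` verts G) \<le> k"
  shows "chromatic_number G \<le> k"
proof -
  have "finite (c ` verts G)" using G unfolding simple_graph_def by simp
  then obtain g where g: "bij_betw g (c ` verts G) {0..<card (c ` verts G)}"
    using ex_bij_betw_finite_nat by blast
  have "proper_coloring G (g \<circ> c)"
    unfolding proper_coloring_def
    using c simple_graph_edge[OF G] bij_betw_imp_inj_on[OF g] by (auto dest: inj_onD)
  moreover have "(g \<circ> c) ` verts G \<subseteq> {..<k}"
    using bij_betwE[OF g] k by fastforce
  ultimately show ?thesis
    unfolding chromatic_number_def by (blast intro: Least_le)
qed

lemma chromatic_number_coloring: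
  assumes G: "simple_graph G"
  obtains c where "proper_coloring G c" "c ` verts G \<subseteq> {..<chromatic_number G}"
proof -
  have "finite (verts G)" using G unfolding simple_graph_def by simp
  then obtain g where g: "bij_betw g (verts G) {0..<card (verts G)}"
    using ex_bij_betw_finite_nat by blast
  have "proper_coloring G g"
    unfolding proper_coloring_def
    using simple_graph_edge[OF G] inj_onD[OF bij_betw_imp_inj_on[OF g]] by metis
  moreover have "g ` verts G \<subseteq> {..<card (verts G)}"
    using bij_betw_imp_surj_on[OF g] by auto
  ultimately have "\<exists>k c. proper_coloring G c \<and> c ` verts G \<subseteq> {..<k}" by blast
  from LeastI_ex[OF this] show ?thesis
    using that unfolding chromatic_number_def by blast
qed

text \<open>The vertex sums of a local antimagic labeling form a proper coloring.\<close>

lemma chromatic_number_le_chi_la: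
  assumes "simple_graph G"
  shows "enat (chromatic_number G) \<le> chi_la G"
  unfolding chi_la_def local_antimagic_labeling_def
  by (intro INF_greatest)
    (auto intro!: chromatic_number_le_card_colors[OF assms, where c = "vertex_sum G _"])

section \<open>The join of a graph with one edgeless graph\<close>

locale join_edgeless =
  fixes G :: "'a graph" and W :: "'a set"
  assumes simple: "simple_graph G" and finite_W: "finite W" and disjoint: "verts G \<inter> W = {}"
begin

abbreviation J :: "'a graph" where
  "J \<equiv> graph_join G (edgeless W)"

text \<open>The new edges, indexed by the cells of a rectangle with rows \<open>W\<close> and
  columns \<open>verts G\<close>.\<close>

definition cross :: "'a set set" where
  "cross = (\<lambda>(w, u). {u, w}) ` (W \<times> verts G)"

lemma finite_V: "finite (verts G)"
  using simple unfolding simple_graph_def by blast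

lemma verts_join: "verts J = verts G \<union> W"
  by (simp add: graph_join_def edgeless_def)

lemma edges_join: "edges J = edges G \<union> cross"
  by (auto simp: graph_join_def edgeless_def cross_def)

lemma edge_subset: "e \<in> edges G \<Longrightarrow> e \<subseteq> verts G"
  using simple unfolding simple_graph_def by auto

lemma edges_disjoint: "edges G \<inter> cross = {}"
  using edge_subset disjoint unfolding cross_def by blast

lemma simple_join: "simple_graph J"
  using simple finite_W disjoint
  unfolding simple_graph_def verts_join edges_join cross_def by (auto simp: card_insert_if)

lemma card_verts_join: "card (verts J) = card (verts G) + card W"
  unfolding verts_join using finite_V finite_W disjoint by (rule card_Un_disjoint)

lemma inj_on_cross: "inj_on (\<lambda>(w, u). {u, w}) (W \<times> verts G)"
  using disjoint by (auto simp: inj_on_def doubleton_eq_iff)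

lemma incident_old:
  assumes "u \<in> verts G"
  shows "{e \<in> edges J. u \<in> e} = {e \<in> edges G. u \<in> e} \<union> (\<lambda>w. {u, w}) ` W"
  using assms disjoint unfolding edges_join cross_def by auto

lemma incident_new:
  assumes "w \<in> W"
  shows "{e \<in> edges J. w \<in> e} = (\<lambda>u. {u, w}) ` verts G"
  using assms disjoint edge_subset unfolding edges_join cross_def by auto

text \<open>Stated for arbitrary weights: a labeling gives vertex sums, the constant 1 gives
  degrees.\<close>

lemma sum_incident_old:
  fixes f :: "'a set \<Rightarrow> nat"
  assumes u: "u \<in> verts G"
  shows "(\<Sum>e \<in> {e \<in> edges J. u \<in> e}. f e) =
    (\<Sum>e \<in> {e \<in> edges G. u \<in> e}. f e) + (\<Sum>w\<in>W. f {u, w})"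
proof -
  have "inj_on (\<lambda>w. {u, w}) W" using u disjoint by (auto simp: inj_on_def doubleton_eq_iff)
  moreover have "{e \<in> edges G. u \<in> e} \<inter> (\<lambda>w. {u, w}) ` W = {}"
    using edge_subset disjoint by blast
  ultimately show ?thesis
    unfolding incident_old[OF u] using finite_edges[OF simple] finite_W
    by (subst sum.union_disjoint) (auto simp: sum.reindex)
qed

lemma sum_incident_new:
  fixes f :: "'a set \<Rightarrow> nat"
  assumes w: "w \<in> W"
  shows "(\<Sum>e \<in> {e \<in> edges J. w \<in> e}. f e) = (\<Sum>u\<in>verts G. f {u, w})"
proof -
  have "inj_on (\<lambda>u. {u, w}) (verts G)" using w disjoint by (auto simp: inj_on_def doubleton_eq_iff)
  then show ?thesis unfolding incident_new[OF w] by (simp add: sum.reindex)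
qed

lemma degree_join_old: "u \<in> verts G \<Longrightarrow> degree J u = degree G u + card W"
  using sum_incident_old[of u "\<lambda>_. 1"] by (simp add: degree_def)

lemma degree_join_new: "w \<in> W \<Longrightarrow> degree J w = card (verts G)"
  using sum_incident_new[of w "\<lambda>_. 1"] by (simp add: degree_def)

text \<open>A vertex of \<open>W\<close> is adjacent to all of \<open>G\<close>, so its color is
  missing on \<open>G\<close>.\<close>

lemma chromatic_number_join:
  assumes "W \<noteq> {}"
  shows "chromatic_number G + 1 \<le> chromatic_number J"
proof -
  obtain c where c: "proper_coloring J c" "c ` verts J \<subseteq> {..<chromatic_number J}"
    using chromatic_number_coloring[OF simple_join] .
  obtain w where w: "w \<in> W" using assms by blast
  have sub: "c ` verts G \<subseteq> {..<chromatic_number J} - {c w}"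
  proof -
    have "c u \<noteq> c w" if "u \<in> verts G" for u
      using c(1) that w unfolding proper_coloring_def edges_join cross_def by force
    then show ?thesis using c(2) unfolding verts_join by auto
  qed
  have "c w < chromatic_number J" using c(2) w unfolding verts_join by auto
  then have "card (c ` verts G) \<le> chromatic_number J - 1"
    using card_mono[OF _ sub] by simp
  then have "chromatic_number G \<le> chromatic_number J - 1"
    using c(1) unfolding proper_coloring_def edges_join
    by (intro chromatic_number_le_card_colors[OF simple, where c = c]) auto
  then show ?thesis using \<open>c w < chromatic_number J\<close> by linarith
qed

lemma chi_la_join_le:
  assumes reg: "regular (2 * r) G" and W: "card W = card (verts G) - 2 * t" "2 \<le> card W"
    and t: "1 \<le> t" "t \<le> r" and m: "5 \<le> card (verts G)"
    and f: "local_antimagic_labeling G f"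
  shows "chi_la J \<le> enat (card (vertex_sum G f ` verts G)) + 1"
proof -
  define m n where "m = card (verts G)" and "n = card W"
  have mn: "m = n + 2 * t" using W unfolding m_def n_def by linarith
  have "n < m" "even n \<longleftrightarrow> even m" using mn t by auto
  then obtain M where M: "bij_betw (\<lambda>(i, j). M i j) ({..<n} \<times> {..<m}) {1..n * m}"
      "\<And>i. i < n \<Longrightarrow> 2 * (\<Sum>j<m. M i j) = m * (n * m + 1)"
      "\<And>j. j < m \<Longrightarrow> 2 * (\<Sum>i<n. M i j) = n * (n * m + 1)"
    using magic_rectangle_exists[of n m] W(2) m unfolding m_def n_def by blast
  obtain a where a: "bij_betw a W {..<n}"
    using ex_bij_betw_finite_nat[OF finite_W] unfolding n_def atLeast0LessThan by blast
  obtain b where b: "bij_betw b (verts G) {..<m}"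
    using ex_bij_betw_finite_nat[OF finite_V] unfolding m_def atLeast0LessThan by blast
  define q where "q = card (edges G)"
  \<comment> \<open>Recovers from a new edge its cell, that is, which end lies in
    \<open>W\<close>.\<close>
  define enc where "enc = the_inv_into (W \<times> verts G) (\<lambda>(w, u). {u, w})"
  have enc: "enc {u, w} = (w, u)" if "u \<in> verts G" "w \<in> W" for u w
    unfolding enc_def using the_inv_into_f_f[OF inj_on_cross, of "(w, u)"] that by simp
  define g where "g e = (if e \<in> edges G then n * m + f e else case enc e of (w, u) \<Rightarrow> M (a w) (b u))" for e
  have g_cross: "g {u, w} = M (a w) (b u)" if "u \<in> verts G" "w \<in> W" for u w
  proof -
    have "{u, w} \<in> cross" using that unfolding cross_def by force
    then show ?thesis using edges_disjoint enc[OF that] unfolding g_def by auto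
  qed
  have f_bij: "bij_betw f (edges G) {1..q}"
    using f unfolding local_antimagic_labeling_def q_def by blast
  have bij_old: "bij_betw g (edges G) {n * m + 1..n * m + q}"
  proof -
    have "bij_betw ((+) (n * m)) {1..q} {n * m + 1..n * m + q}"
      by (auto simp: bij_betw_def)
    from bij_betw_trans[OF f_bij this] show ?thesis
      by (rule bij_betw_cong[THEN iffD1, rotated]) (simp add: g_def)
  qed
  have bij_new: "bij_betw g cross {1..n * m}"
  proof -
    have "bij_betw (map_prod a b) (W \<times> verts G) ({..<n} \<times> {..<m})"
      using a b by (rule bij_betw_map_prod)
    from bij_betw_trans[OF this M(1)]
    have "bij_betw (g \<circ> (\<lambda>(w, u). {u, w})) (W \<times> verts G) {1..n * m}"
      by (rule bij_betw_cong[THEN iffD1, rotated]) (auto simp: g_cross)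
    then show ?thesis
      using inj_on_cross unfolding cross_def bij_betw_def image_comp
      by (metis bij_betw_def comp_inj_on_iff image_comp inj_on_imageI)
  qed
  have "bij_betw g (edges G \<union> cross) ({n * m + 1..n * m + q} \<union> {1..n * m})"
    by (rule bij_betw_combine[OF bij_old bij_new]) auto
  moreover have "{n * m + 1..n * m + q} \<union> {1..n * m} = {1..n * m + q}" by auto
  ultimately have bij: "bij_betw g (edges J) {1..n * m + q}" unfolding edges_join by simp
  then have "card (edges J) = n * m + q" using bij_betw_same_card by fastforce
  with bij have bij: "bij_betw g (edges J) {1..card (edges J)}" by simp
  have new: "2 * vertex_sum J g w = m * (n * m + 1)" if w: "w \<in> W" for w
  proof -
    have "vertex_sum J g w = (\<Sum>u\<in>verts G. M (a w) (b u))"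
      unfolding vertex_sum_def sum_incident_new[OF w] using g_cross w by (intro sum.cong) auto
    also have "\<dots> = (\<Sum>j<m. M (a w) j)" by (rule sum.reindex_bij_betw[OF b])
    finally show ?thesis using M(2)[of "a w"] bij_betwE[OF a] w by auto
  qed
  have old: "2 * vertex_sum J g u = 2 * vertex_sum G f u + 4 * r * (n * m) + n * (n * m + 1)"
    if u: "u \<in> verts G" for u
  proof -
    have "(\<Sum>w\<in>W. g {u, w}) = (\<Sum>w\<in>W. M (a w) (b u))"
      using g_cross u by (intro sum.cong) auto
    also have "\<dots> = (\<Sum>i<n. M i (b u))" by (rule sum.reindex_bij_betw[OF a])
    finally have 1: "2 * (\<Sum>w\<in>W. g {u, w}) = n * (n * m + 1)"
      using M(3)[of "b u"] bij_betwE[OF b] u by auto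
    have "(\<Sum>e \<in> {e \<in> edges G. u \<in> e}. g e) = (\<Sum>e \<in> {e \<in> edges G. u \<in> e}. n * m + f e)"
      by (intro sum.cong) (auto simp: g_def)
    also have "\<dots> = degree G u * (n * m) + vertex_sum G f u"
      by (simp add: sum.distrib degree_def vertex_sum_def)
    also have "degree G u = 2 * r" using reg u unfolding regular_def by blast
    finally show ?thesis
      using 1 unfolding vertex_sum_def[of J] sum_incident_old[OF u] by (simp add: algebra_simps)
  qed
  \<comment> \<open>The common increase of all old sums; column 0 stands for every column, as all
    column sums agree.\<close>
  define C where "C = 2 * r * (n * m) + (\<Sum>i<n. M i 0)"
  have old': "vertex_sum J g u = vertex_sum G f u + C" if "u \<in> verts G" for u
    using old[OF that] M(3)[of 0] m unfolding C_def m_def by simp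
  \<comment> \<open>In doubled sums, a row exceeds a column by \<open>2t (nm + 1)\<close>, while the
    shift of the \<open>2r\<close> old labels at a vertex adds \<open>4r nm\<close>; this is larger
    because \<open>t \<le> r\<close> and \<open>nm > 1\<close>.\<close>
  have less: "m * (n * m + 1) < 4 * r * (n * m) + n * (n * m + 1)"
  proof -
    have "m * (n * m + 1) = n * (n * m + 1) + 2 * t * (n * m + 1)"
      unfolding mn by (simp add: algebra_simps)
    moreover have "2 * t * (n * m + 1) \<le> 2 * r * (n * m + 1)"
      using t by (intro mult_le_mono) simp_all
    moreover have "2 * r * (n * m + 1) < 4 * r * (n * m)"
    proof -
      have "2 \<le> n" "5 \<le> m" using W(2) m unfolding n_def m_def by auto
      then have "2 * 5 \<le> n * m" by (rule mult_le_mono)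
      then have "n * m + 1 < 2 * (n * m)" by linarith
      then have "2 * r * (n * m + 1) < 2 * r * (2 * (n * m))" using t by simp
      then show ?thesis by simp
    qed
    ultimately show ?thesis by linarith
  qed
  have neq: "vertex_sum J g w \<noteq> vertex_sum J g u" if "u \<in> verts G" "w \<in> W" for u w
    using new[OF that(2)] old[OF that(1)] less by linarith
  have "vertex_sum J g u \<noteq> vertex_sum J g v" if uv: "{u, v} \<in> edges J" for u v
  proof (cases "{u, v} \<in> edges G")
    case True
    then have "vertex_sum G f u \<noteq> vertex_sum G f v"
      using f unfolding local_antimagic_labeling_def by blast
    then show ?thesis using old' simple_graph_edge[OF simple True] by simp
  next
    case False
    then have "{u, v} \<in> cross" using uv unfolding edges_join by blast
    then have "u \<in> verts G \<and> v \<in> W \<or> v \<in> verts G \<and> u \<in> W"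
      unfolding cross_def by (auto simp: doubleton_eq_iff)
    then show ?thesis using neq by metis
  qed
  with bij have lab: "local_antimagic_labeling J g"
    unfolding local_antimagic_labeling_def by blast
  obtain w0 where w0: "w0 \<in> W" using W(2) by fastforce
  have "vertex_sum J g ` verts J \<subseteq>
      insert (vertex_sum J g w0) ((\<lambda>s. s + C) ` vertex_sum G f ` verts G)"
  proof -
    have "vertex_sum J g w = vertex_sum J g w0" if "w \<in> W" for w
      using new[OF that] new[OF w0] by linarith
    then show ?thesis using old' unfolding verts_join by auto
  qed
  then have "card (vertex_sum J g ` verts J) \<le>
      card (insert (vertex_sum J g w0) ((\<lambda>s. s + C) ` vertex_sum G f ` verts G))"
    using finite_V by (intro card_mono) auto
  also have "\<dots> \<le> Suc (card ((\<lambda>s. s + C) ` vertex_sum G f ` verts G))"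
    using finite_V by (simp add: card_insert_if)
  also have "card ((\<lambda>s. s + C) ` vertex_sum G f ` verts G) = card (vertex_sum G f ` verts G)"
    by (rule card_image) (simp add: inj_on_def)
  finally have "enat (card (vertex_sum J g ` verts J)) \<le> enat (card (vertex_sum G f ` verts G)) + 1"
    by (simp add: one_enat_def)
  moreover have "chi_la J \<le> enat (card (vertex_sum J g ` verts J))"
    unfolding chi_la_def using lab by (intro INF_lower) simp
  ultimately show ?thesis by (rule order_trans[rotated])
qed

text \<open>Both equalities come from the cycle \<open>chi_la G + 1 \<le> chromatic_number J \<le>
  chi_la J \<le> chi_la G + 1\<close>; the second one allows iteration.\<close>

lemma chi_la_join:
  assumes "regular (2 * r) G" "card W = card (verts G) - 2 * t" "2 \<le> card W"
    "1 \<le> t" "t \<le> r" "5 \<le> card (verts G)"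
    and chi: "enat (chromatic_number G) = chi_la G"
  shows "chi_la J = chi_la G + 1" "enat (chromatic_number J) = chi_la J"
proof -
  let ?A = "(\<lambda>f. enat (card (vertex_sum G f ` verts G))) ` {f. local_antimagic_labeling G f}"
  \<comment> \<open>Being equal to a chromatic number, \<open>chi_la G\<close> is finite, so a
    labeling exists and the infimum is attained.\<close>
  have "?A \<noteq> {}"
  proof
    assume "?A = {}"
    then have "chi_la G = top" unfolding chi_la_def by (simp only: Inf_empty)
    then show False using chi by (simp add: top_enat_def)
  qed
  then have "Inf ?A \<in> ?A" by (auto simp: Inf_enat_def intro: LeastI)
  then obtain f where f: "local_antimagic_labeling G f"
      "chi_la G = enat (card (vertex_sum G f ` verts G))"
    unfolding chi_la_def by auto
  have "chi_la J \<le> chi_la G + 1"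
    unfolding f(2) using assms f(1) by (intro chi_la_join_le)
  moreover have "enat (chromatic_number J) \<le> chi_la J"
    by (rule chromatic_number_le_chi_la[OF simple_join])
  moreover have "chi_la G + 1 \<le> enat (chromatic_number J)"
    using chromatic_number_join assms(3) unfolding chi[symmetric] one_enat_def by fastforce
  ultimately show "chi_la J = chi_la G + 1" "enat (chromatic_number J) = chi_la J" by order+
qed

end

theorem theorem3p3:
  fixes G :: "'a graph" and m r :: nat
  assumes "simple_graph G"
    and "regular (2 * r) G"
    and "card (verts G) = m"
    and "m \<ge> 3"
    and "enat (chromatic_number G) = chi_la G"
    and "r \<ge> 2"
  shows
    "(\<forall>t W. 1 \<le> t \<and> t \<le> r \<and> m - 2 * t \<ge> 2 \<and>
        finite W \<and> card W = m - 2 * t \<and> verts G \<inter> W = {} \<longrightarrow>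
        chi_la (graph_join G (edgeless W)) = chi_la G + 1) \<and>
     (even m \<and> m - 2 * r \<ge> 2 \<longrightarrow>
        (\<forall>k H. iterated_join G (m - 2 * r) (Suc k) H \<longrightarrow>
           simple_graph H \<and>
           regular (2 * r + (k + 1) * (m - 2 * r)) H \<and>
           card (verts H) = m + (k + 1) * (m - 2 * r)) \<and>
        (\<forall>k H. iterated_join G (m - 2 * r) k H \<longrightarrow> chi_la H = chi_la G + enat k))"
proof -
  obtain v where "v \<in> verts G" using assms(3,4) by fastforce
  \<comment> \<open>A vertex of degree \<open>2r \<ge> 4\<close> has at least four
    neighbors.\<close>
  then have m5: "5 \<le> m"
    using degree_less_order[OF assms(1)] assms(2,3,6) unfolding regular_def by fastforce
  have join: "chi_la (graph_join G (edgeless W)) = chi_la G + 1"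
    if "1 \<le> t" "t \<le> r" "m - 2 * t \<ge> 2" "finite W" "card W = m - 2 * t" "verts G \<inter> W = {}" for t W
  proof -
    interpret join_edgeless G W using assms(1) that by unfold_locales
    show ?thesis using chi_la_join(1)[of r t] assms that m5 by simp
  qed
  \<comment> \<open>The induction also carries the equality of the two chromatic parameters, the
    hypothesis of the next join.\<close>
  have iter: "simple_graph H \<and> regular (2 * r + k * (m - 2 * r)) H \<and>
      card (verts H) = m + k * (m - 2 * r) \<and>
      chi_la H = chi_la G + enat k \<and> enat (chromatic_number H) = chi_la H"
    if "iterated_join G (m - 2 * r) k H" "even m" "m - 2 * r \<ge> 2" for k H
    using that
  proof (induction rule: iterated_join.induct)
    case base
    then show ?case using assms by (simp flip: zero_enat_def)
  next
    case (step k H W)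
    define n where "n = m - 2 * r"
    have mn: "m = n + 2 * r" using step.prems unfolding n_def by simp
    have IH: "simple_graph H" "regular (2 * r + k * n) H" "card (verts H) = m + k * n"
      "chi_la H = chi_la G + enat k" "enat (chromatic_number H) = chi_la H"
      using step unfolding n_def by auto
    have W: "finite W" "card W = n" "verts H \<inter> W = {}" using step unfolding n_def by auto
    interpret join_edgeless H W using IH(1) W by unfold_locales
    have "even n" using step.prems mn by auto
    then obtain s where s: "n = 2 * s" by blast
    \<comment> \<open>Order and degree both grow by \<open>n\<close>, so their difference stays
      \<open>n\<close>. Hence \<open>r + k * s\<close> serves as both \<open>r\<close> and
      \<open>t\<close> in the next join; evenness of \<open>n\<close> keeps the degree even.\<close>
    have r': "2 * r + k * n = 2 * (r + k * s)" unfolding s by (simp add: algebra_simps)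
    have "regular (2 * (r + k * s)) H" using IH(2) unfolding r' .
    moreover have "card W = card (verts H) - 2 * (r + k * s)"
      unfolding IH(3) W(2) r'[symmetric] mn by simp
    ultimately have "chi_la J = chi_la H + 1" "enat (chromatic_number J) = chi_la J"
      using chi_la_join[of "r + k * s" "r + k * s"] IH W step.prems m5 assms(6)
      unfolding n_def by auto
    moreover have "regular (2 * r + Suc k * n) J"
      using IH(2,3) degree_join_old degree_join_new W(2) mn
      unfolding regular_def verts_join by auto
    moreover have "card (verts J) = m + Suc k * n"
      unfolding card_verts_join IH(3) W(2) by simp
    moreover have "chi_la G + enat k + 1 = chi_la G + enat (Suc k)"
      by (simp add: add.assoc one_enat_def)
    ultimately show ?case using simple_join IH(4) unfolding n_def by simp
  qed
  show ?thesis
  proof (intro conjI allI impI)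
    fix t W
    assume "1 \<le> t \<and> t \<le> r \<and> m - 2 * t \<ge> 2 \<and> finite W \<and> card W = m - 2 * t \<and> verts G \<inter> W = {}"
    then show "chi_la (graph_join G (edgeless W)) = chi_la G + 1" using join by blast
  qed (use iter in \<open>simp_all del: mult_Suc\<close>)
qed

end
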